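(* Let $f=\{f_1,\ldots,f_k\}\subset\mathbb{R}[x_1,\ldots,x_n]$, let $\beta>0$, and let $a=(a_0,a_1,\ldots,a_n)\in\mathbb{R}^{n+1}$ be a point of the unit ball $B(0;1)$ of $\mathbb{R}^{n+1}$. Let $\bar{\mu}_{\min}$ be the global minimal value over $(x_0,x_1,\ldots,x_n)\in\mathbb{R}^{n+1}$ of $$\bar{\mu}=\frac{1}{2}\Big(\beta\cdot\big(\bar f_1^2+\cdots+\bar f_k^2+\bar f_{k+1}^2\big)+\sum_{i=0}^n (x_i-a_i)^2\Big).$$ If $\bar{\mu}_{\min}>2$, then $V_{\mathbb{R}}(f)=\emptyset$.
   Context: $V_{\mathbb{R}}(f)\subseteq\mathbb{R}^n$ denotes the set of common real zeros of $f_1,\ldots,f_k$. For $1\le i\le k$, $\bar f_i\in\mathbb{R}[x_0,x_1,\ldots,x_n]$ is the homogenization of $f_i$ with respect to the additional variable $x_0$, and $\bar f_{k+1}=\sum_{i=0}^n x_i^2-1$. The system $\bar f=\{\bar f_1,\ldots,\bar f_{k+1}\}$ is called the homogenized system of $f$. *)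

theory Defs
  imports "HOL-Analysis.Analysis" "HOL-Library.Poly_Mapping"
begin

text \<open>Polynomials over the reals with variables indexed by the finite type \<open>'v\<close>: a monomial is an
  exponent vector \<open>'v \<Rightarrow>\<^sub>0 nat\<close> and a polynomial is a finitely supported coefficient function on
  monomials. The ring structure is the convolution product of \<^theory>\<open>HOL-Library.Poly_Mapping\<close>.\<close>

type_synonym 'v mpoly = "('v \<Rightarrow>\<^sub>0 nat) \<Rightarrow>\<^sub>0 real"

definition Var :: "'v \<Rightarrow> 'v mpoly" where
  "Var i = Poly_Mapping.single (Poly_Mapping.single i 1) 1"

definition eval_mpoly :: "'v::finite mpoly \<Rightarrow> real ^ 'v \<Rightarrow> real" where
  "eval_mpoly p x =
     (\<Sum>m\<in>Poly_Mapping.keys p.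
        Poly_Mapping.lookup p m * (\<Prod>i\<in>UNIV. (x $ i) ^ Poly_Mapping.lookup m i))"

definition monom_degree :: "('v::finite \<Rightarrow>\<^sub>0 nat) \<Rightarrow> nat" where
  "monom_degree m = (\<Sum>i\<in>UNIV. Poly_Mapping.lookup m i)"

definition total_degree :: "'v::finite mpoly \<Rightarrow> nat" where
  "total_degree p = Max (insert 0 (monom_degree ` Poly_Mapping.keys p))"

text \<open>The variables \<open>x\<^sub>0, x\<^sub>1, \<dots>, x\<^sub>n\<close> are indexed by \<open>'n option\<close>: \<open>None\<close> stands for the index \<open>0\<close> of
  the homogenizing variable, and \<open>Some i\<close> for the original index \<open>i\<close>. Accordingly the space of
  dimension \<open>n + 1\<close> is \<open>real ^ 'n option\<close>.\<close>

definition homogenize_monom :: "nat \<Rightarrow> ('n::finite \<Rightarrow>\<^sub>0 nat) \<Rightarrow> ('n option \<Rightarrow>\<^sub>0 nat)" where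
  "homogenize_monom d m =
     Poly_Mapping.single None (d - monom_degree m) +
     (\<Sum>i\<in>UNIV. Poly_Mapping.single (Some i) (Poly_Mapping.lookup m i))"

definition homogenize :: "'n::finite mpoly \<Rightarrow> 'n option mpoly" where
  "homogenize p =
     (\<Sum>m\<in>Poly_Mapping.keys p.
        Poly_Mapping.single (homogenize_monom (total_degree p) m) (Poly_Mapping.lookup p m))"

definition sphere_poly :: "'v::finite mpoly" where
  "sphere_poly = (\<Sum>i\<in>UNIV. Var i ^ 2) - 1"

definition homogenized_system :: "'n::finite mpoly list \<Rightarrow> 'n option mpoly list" where
  "homogenized_system fs = map homogenize fs @ [sphere_poly]"

definition real_zeros :: "'v::finite mpoly list \<Rightarrow> (real ^ 'v) set" where
  "real_zeros fs = {x. \<forall>f\<in>set fs. eval_mpoly f x = 0}"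

definition mu_bar ::
  "'n::finite mpoly list \<Rightarrow> real \<Rightarrow> real ^ 'n option \<Rightarrow> real ^ 'n option \<Rightarrow> real" where
  "mu_bar fs \<beta> a x =
     1 / 2 * (\<beta> * (\<Sum>g\<leftarrow>homogenized_system fs. (eval_mpoly g x)\<^sup>2) + (\<Sum>i\<in>UNIV. (x $ i - a $ i)\<^sup>2))"

text \<open>The least element of the set of values. Statements about \<open>mu_bar_min\<close> therefore implicitly
  rely on the minimum being attained, which holds for \<open>\<beta> \<ge> 0\<close> because \<open>mu_bar\<close> is then continuous
  and coercive.\<close>

definition mu_bar_min :: "'n::finite mpoly list \<Rightarrow> real \<Rightarrow> real ^ 'n option \<Rightarrow> real" where
  "mu_bar_min fs \<beta> a = (LEAST v. v \<in> range (mu_bar fs \<beta> a))"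

end

theory Submission
  imports Defs
begin

text \<open>
  A real zero \<open>x\<close> of the system yields a common zero of the homogenized system on the unit sphere:
  each homogenized polynomial vanishes on the whole line through \<open>(1, x)\<close>, and the unit vector
  \<open>y\<close> on that line is a zero of the sphere equation as well. At \<open>y\<close> only the distance term of
  \<open>mu_bar\<close> survives, and it is half the squared distance of two points of the unit ball,
  hence at most \<open>2\<^sup>2 / 2 = 2\<close>. So a minimal value above \<open>2\<close> excludes real zeros.

  That \<open>mu_bar_min\<close> is a lower bound of \<open>mu_bar\<close> requires the minimum to be attained. It is,
  because \<open>mu_bar\<close> is continuous and dominates half the squared distance to \<open>a\<close>, so that
  the search for a minimum can be confined to a compact ball around \<open>a\<close>.
\<close>

section \<open>Evaluation of polynomials\<close>

text \<open>Different monomials of a sum may cancel or merge; summing over a common finite superset of the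
  supports makes evaluation manifestly linear.\<close>

lemma eval_mpoly_superset:
  assumes "finite S" "Poly_Mapping.keys p \<subseteq> S"
  shows "eval_mpoly p x =
    (\<Sum>m\<in>S. Poly_Mapping.lookup p m * (\<Prod>i\<in>UNIV. (x $ i) ^ Poly_Mapping.lookup m i))"
  unfolding eval_mpoly_def
  by (rule sum.mono_neutral_left) (use assms in \<open>auto simp: in_keys_iff\<close>)

lemma eval_mpoly_zero [simp]: "eval_mpoly 0 x = 0"
  by (simp add: eval_mpoly_def)

lemma eval_mpoly_add: "eval_mpoly (p + q) x = eval_mpoly p x + eval_mpoly q x"
proof -
  let ?S = "Poly_Mapping.keys p \<union> Poly_Mapping.keys q"
  have "Poly_Mapping.keys (p + q) \<subseteq> ?S"
    by (rule Poly_Mapping.keys_add)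
  then show ?thesis
    by (simp add: eval_mpoly_superset[of ?S] lookup_add distrib_right sum.distrib)
qed

lemma eval_mpoly_diff: "eval_mpoly (p - q) x = eval_mpoly p x - eval_mpoly q x"
  using eval_mpoly_add[of "p - q" q x] by simp

lemma eval_mpoly_sum: "eval_mpoly (\<Sum>j\<in>A. p j) x = (\<Sum>j\<in>A. eval_mpoly (p j) x)"
  by (induction A rule: infinite_finite_induct) (simp_all add: eval_mpoly_add)

lemma eval_mpoly_single:
  "eval_mpoly (Poly_Mapping.single m c) x = c * (\<Prod>i\<in>UNIV. (x $ i) ^ Poly_Mapping.lookup m i)"
  by (simp add: eval_mpoly_superset[of "{m}"])

lemma eval_mpoly_one [simp]: "eval_mpoly 1 x = 1"
  by (simp add: eval_mpoly_single flip: single_one)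

lemma eval_mpoly_Var_square: "eval_mpoly (Var i ^ 2) x = (x $ i)\<^sup>2"
proof -
  have "Var i ^ 2 = Poly_Mapping.single (Poly_Mapping.single i 2) (1::real)"
    by (simp add: Var_def power2_eq_square mult_single numeral_2_eq_2 flip: single_add)
  moreover have "(\<Prod>j\<in>UNIV. (x $ j) ^ Poly_Mapping.lookup (Poly_Mapping.single i 2) j) = 
      (\<Prod>j\<in>UNIV. if j = i then (x $ i)\<^sup>2 else 1)"
    by (rule prod.cong) (auto simp: lookup_single when_def)
  ultimately show ?thesis
    by (simp add: eval_mpoly_single)
qed

lemma sum_squares_eq_norm: "(\<Sum>i\<in>UNIV. (x $ i)\<^sup>2) = (norm x)\<^sup>2" for x :: "real ^ 'v::finite"
  unfolding power2_norm_eq_inner inner_vec_def by (simp add: power2_eq_square)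

lemma eval_sphere_poly: "eval_mpoly sphere_poly x = (norm x)\<^sup>2 - 1"
  by (simp add: sphere_poly_def eval_mpoly_diff eval_mpoly_sum eval_mpoly_Var_square
      sum_squares_eq_norm)

lemma continuous_on_eval_mpoly [continuous_intros]: "continuous_on S (eval_mpoly p)"
  unfolding eval_mpoly_def by (intro continuous_intros)

section \<open>Homogenization\<close>

lemma lookup_homogenize_monom_None:
  "Poly_Mapping.lookup (homogenize_monom d m) None = d - monom_degree m"
  by (simp add: homogenize_monom_def lookup_add lookup_sum lookup_single when_def)

lemma lookup_homogenize_monom_Some:
  "Poly_Mapping.lookup (homogenize_monom d m) (Some i) = Poly_Mapping.lookup m i"
  by (simp add: homogenize_monom_def lookup_add lookup_sum lookup_single when_def)

lemma prod_UNIV_option: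
  "(\<Prod>i\<in>UNIV. g i) = g None * (\<Prod>i\<in>UNIV. g (Some i))"
  for g :: "'n::finite option \<Rightarrow> real"
  by (simp add: UNIV_option_conv prod.reindex)

lemma monom_degree_le_total_degree:
  "m \<in> Poly_Mapping.keys p \<Longrightarrow> monom_degree m \<le> total_degree p"
  unfolding total_degree_def by (rule Max_ge) auto

definition affine_lift :: "real ^ 'n \<Rightarrow> real ^ 'n::finite option" where
  "affine_lift x = (\<chi> i. case i of None \<Rightarrow> 1 | Some j \<Rightarrow> x $ j)"

text \<open>Every monomial of degree \<open>e\<close> contributes a factor \<open>c ^ e\<close> from the original variables and the
  complementary factor \<open>c ^ (d - e)\<close> from the homogenizing variable, where \<open>d\<close> is the
  total degree; the truncated subtraction is exact because \<open>e \<le> d\<close>.\<close>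

lemma eval_homogenize_scaled_lift:
  "eval_mpoly (homogenize p) (c *\<^sub>R affine_lift x) = c ^ total_degree p * eval_mpoly p x"
proof -
  let ?d = "total_degree p"
  have monom: "(\<Prod>i\<in>UNIV. ((c *\<^sub>R affine_lift x) $ i)
        ^ Poly_Mapping.lookup (homogenize_monom ?d m) i)
      = c ^ ?d * (\<Prod>i\<in>UNIV. (x $ i) ^ Poly_Mapping.lookup m i)"
    if m: "m \<in> Poly_Mapping.keys p" for m
  proof -
    have "(\<Prod>i\<in>UNIV. ((c *\<^sub>R affine_lift x) $ i) ^ Poly_Mapping.lookup (homogenize_monom ?d m) i)
        = c ^ (?d - monom_degree m) * (\<Prod>i\<in>UNIV. (c * x $ i) ^ Poly_Mapping.lookup m i)"
      by (simp add: prod_UNIV_option lookup_homogenize_monom_None lookup_homogenize_monom_Some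
          affine_lift_def)
    also have "(\<Prod>i\<in>UNIV. (c * x $ i) ^ Poly_Mapping.lookup m i)
        = c ^ monom_degree m * (\<Prod>i\<in>UNIV. (x $ i) ^ Poly_Mapping.lookup m i)"
      by (simp add: power_mult_distrib prod.distrib monom_degree_def power_sum)
    finally show ?thesis
      using monom_degree_le_total_degree[OF m] by (simp flip: mult.assoc power_add)
  qed
  have "eval_mpoly (homogenize p) (c *\<^sub>R affine_lift x) =
      (\<Sum>m\<in>Poly_Mapping.keys p. Poly_Mapping.lookup p m *
        (\<Prod>i\<in>UNIV. ((c *\<^sub>R affine_lift x) $ i) ^ Poly_Mapping.lookup (homogenize_monom ?d m) i))"
    unfolding homogenize_def eval_mpoly_sum eval_mpoly_single ..
  also have "\<dots> = c ^ ?d * eval_mpoly p x"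
    by (simp add: monom eval_mpoly_def sum_distrib_left mult.left_commute del: vector_scaleR_component)
  finally show ?thesis .
qed

lemma homogenized_system_zero_on_sphere:
  assumes "x \<in> real_zeros fs"
  obtains y where "norm y = 1" "y \<in> real_zeros (homogenized_system fs)"
proof
  let ?y = "inverse (norm (affine_lift x)) *\<^sub>R affine_lift x"
  have "affine_lift x $ None = 1"
    by (simp add: affine_lift_def)
  then have "affine_lift x \<noteq> 0"
    by auto
  then show unit: "norm ?y = 1"
    by simp
  show "?y \<in> real_zeros (homogenized_system fs)"
    using assms unit
    by (auto simp: real_zeros_def homogenized_system_def eval_homogenize_scaled_lift
        eval_sphere_poly simp del: norm_scaleR)
qed

section \<open>Attainment of the minimum\<close>

lemma continuous_coercive_attains_min:
  fixes h :: "'a::heine_borel \<Rightarrow> real"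
  assumes cont: "continuous_on UNIV h"
    and lower: "\<And>x. (dist a x)\<^sup>2 / 2 \<le> h x"
  obtains x where "\<And>y. h x \<le> h y"
proof -
  \<comment> \<open>Outside the ball of radius \<open>r\<close> the lower bound already exceeds the value at the centre.\<close>
  define r where "r = sqrt (2 * h a)"
  have nonneg: "0 \<le> h a"
    using lower[of a] by simp
  then have r: "0 \<le> r" "r\<^sup>2 = 2 * h a"
    by (simp_all add: r_def)
  obtain x where x: "\<And>y. y \<in> cball a r \<Longrightarrow> h x \<le> h y"
    using continuous_attains_inf[of "cball a r" h] continuous_on_subset[OF cont] r
    by (metis centre_in_cball compact_cball empty_iff subset_UNIV)
  have "h x \<le> h y" for y
  proof (cases "y \<in> cball a r")
    case False
    then have "r\<^sup>2 \<le> (dist a y)\<^sup>2"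
      using r by (intro power_mono) auto
    then have "h a \<le> h y"
      using lower[of y] r by linarith
    then show ?thesis
      using x[of a] r by simp
  qed (rule x)
  then show thesis by (rule that)
qed

lemma mu_bar_eq:
  "mu_bar fs \<beta> a x =
     1 / 2 * (\<beta> * (\<Sum>g\<leftarrow>homogenized_system fs. (eval_mpoly g x)\<^sup>2) + (dist a x)\<^sup>2)"
  using sum_squares_eq_norm[of "x - a"]
  by (simp add: mu_bar_def dist_norm norm_minus_commute)

lemma continuous_on_sum_list_eval_squares:
  "continuous_on S (\<lambda>x. \<Sum>g\<leftarrow>gs. (eval_mpoly g x)\<^sup>2)"
  by (induction gs) (auto intro!: continuous_intros)

lemma mu_bar_min_le:
  assumes "0 \<le> \<beta>"
  shows "mu_bar_min fs \<beta> a \<le> mu_bar fs \<beta> a y"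
proof -
  have "continuous_on UNIV (mu_bar fs \<beta> a)"
    unfolding mu_bar_eq by (intro continuous_intros continuous_on_sum_list_eval_squares)
  moreover have "(dist a x)\<^sup>2 / 2 \<le> mu_bar fs \<beta> a x" for x
    using assms by (auto simp: mu_bar_eq intro!: mult_nonneg_nonneg sum_list_nonneg)
  ultimately obtain x where x: "\<And>y. mu_bar fs \<beta> a x \<le> mu_bar fs \<beta> a y"
    using continuous_coercive_attains_min by blast
  then have "mu_bar_min fs \<beta> a = mu_bar fs \<beta> a x"
    unfolding mu_bar_min_def by (intro Least_equality) auto
  with x show ?thesis by simp
qed

lemma mu_bar_at_homogenized_zero:
  assumes "y \<in> real_zeros (homogenized_system fs)"
  shows "mu_bar fs \<beta> a y = (dist a y)\<^sup>2 / 2"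
proof -
  have "map (\<lambda>g. (eval_mpoly g y)\<^sup>2) (homogenized_system fs) = map (\<lambda>_. 0) (homogenized_system fs)"
    using assms by (auto simp: real_zeros_def)
  then show ?thesis
    by (simp add: mu_bar_eq del: map_eq_conv)
qed

section \<open>The certificate of emptiness\<close>

theorem proposition4p1:
  fixes fs :: "'n::finite mpoly list"
    and \<beta> :: real
    and a :: "real ^ 'n option"
  assumes "\<beta> > 0"
    and "a \<in> cball 0 1"
    and "mu_bar_min fs \<beta> a > 2"
  shows "real_zeros fs = {}"
proof (rule ccontr)
  assume "real_zeros fs \<noteq> {}"
  then obtain x where "x \<in> real_zeros fs"
    by auto
  then obtain y where y: "norm y = 1" "y \<in> real_zeros (homogenized_system fs)"
    by (rule homogenized_system_zero_on_sphere)
  have "dist a y \<le> 2"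
    using norm_triangle_ineq4[of a y] y assms(2) by (simp add: dist_norm)
  then have "(dist a y)\<^sup>2 \<le> 2\<^sup>2"
    by (intro power_mono) auto
  then have "mu_bar fs \<beta> a y \<le> 2"
    by (simp add: mu_bar_at_homogenized_zero[OF y(2)])
  then show False
    using mu_bar_min_le[of \<beta> fs a y] assms(1,3) by linarith
qed

end
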